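(* Let $A$ be an MV-algebra with $|A|\ge 3$. Then the girth of its zero-divisor graph is $$\mathrm{gr}(\Gamma(A))=\begin{cases}\infty, & \text{if } A\cong L_3,\ A\cong L_4,\ A\cong L_5,\ A\cong B_4\ \text{or}\ A\cong L_2\times L_3;\\ 3, & \text{otherwise.}\end{cases}$$
   Context: An MV-algebra is an algebra $(A,\oplus,*,0)$ of type $(2,1,0)$ such that $(A,\oplus,0)$ is a commutative monoid, $x^{**}=x$, $x\oplus 0^*=0^*$, and $(x^*\oplus y)^*\oplus y=(y^*\oplus x)^*\oplus x$ for all $x,y$. Put $1=0^*$ and $x\odot y=(x^*\oplus y^* )^*$. The direct product of MV-algebras is the cartesian product with pointwise operations. For $n\ge 2$, $L_n=\{0,\frac1{n-1},\dots,\frac{n-2}{n-1},1\}$ is the MV-algebra with $x\oplus y=\min\{1,x+y\}$, $x^*=1-x$. $B_4$ is the 4-element Boolean algebra regarded as an MV-algebra ($\oplus$ is join, $*$ is complement), so $B_4\cong L_2\times L_2$. The zero-divisor graph $\Gamma(A)$ is the simple graph whose vertices are the nonzero zero-divisors of $A$, i.e. the elements $x\ne 0$ with $x\odot y=0$ for some $y\neq 0$, with distinct vertices $x,y$ adjacent iff $x\odot y=0$. The girth $\mathrm{gr}(\Gamma)$ of a graph is the length of a shortest cycle (cycles have at least three vertices), and is $\infty$ if there is no cycle. *)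

theory Defs
  imports
    Complex_Main
    "HOL-Library.Extended_Nat"
    "HOL-Algebra.Group"
    "Graph_Theory.Pair_Digraph"
begin

section \<open>MV-algebras\<close>

record 'a mv = "'a partial_object" +
  mv_plus :: "'a \<Rightarrow> 'a \<Rightarrow> 'a" (infixl \<open>\<oplus>\<index>\<close> 65)
  mv_neg :: "'a \<Rightarrow> 'a" (\<open>\<sim>\<index> _\<close> [81] 80)
  mv_zero :: 'a (\<open>\<zero>\<index>\<close>)

locale mv_algebra =
  fixes A :: "('a, 'm) mv_scheme" (structure)
  assumes plus_comm_monoid:
      "comm_monoid \<lparr>carrier = carrier A, monoid.mult = mv_plus A, one = mv_zero A\<rparr>"
    and neg_closed: "x \<in> carrier A \<Longrightarrow> \<sim> x \<in> carrier A"
    and neg_neg: "x \<in> carrier A \<Longrightarrow> \<sim> (\<sim> x) = x"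
    and plus_neg_zero: "x \<in> carrier A \<Longrightarrow> x \<oplus> \<sim> \<zero> = \<sim> \<zero>"
    and plus_neg_swap: "\<lbrakk>x \<in> carrier A; y \<in> carrier A\<rbrakk> \<Longrightarrow>
      \<sim> (\<sim> x \<oplus> y) \<oplus> y = \<sim> (\<sim> y \<oplus> x) \<oplus> x"

definition mv_times :: "('a, 'm) mv_scheme \<Rightarrow> 'a \<Rightarrow> 'a \<Rightarrow> 'a" (infixl \<open>\<odot>\<index>\<close> 70) where
  "x \<odot>\<^bsub>A\<^esub> y = \<sim>\<^bsub>A\<^esub> (\<sim>\<^bsub>A\<^esub> x \<oplus>\<^bsub>A\<^esub> \<sim>\<^bsub>A\<^esub> y)"

definition mv_iso :: "('a, 'm) mv_scheme \<Rightarrow> ('b, 'n) mv_scheme \<Rightarrow> bool" (infix \<open>\<cong>\<^sub>M\<^sub>V\<close> 50) where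
  "A \<cong>\<^sub>M\<^sub>V B \<longleftrightarrow> (\<exists>f. bij_betw f (carrier A) (carrier B) \<and>
     (\<forall>x\<in>carrier A. \<forall>y\<in>carrier A. f (x \<oplus>\<^bsub>A\<^esub> y) = f x \<oplus>\<^bsub>B\<^esub> f y) \<and>
     (\<forall>x\<in>carrier A. f (\<sim>\<^bsub>A\<^esub> x) = \<sim>\<^bsub>B\<^esub> f x) \<and>
     f \<zero>\<^bsub>A\<^esub> = \<zero>\<^bsub>B\<^esub>)"

definition mv_prod :: "('a, 'm) mv_scheme \<Rightarrow> ('b, 'n) mv_scheme \<Rightarrow> ('a \<times> 'b) mv" (infixr \<open>\<times>\<^sub>M\<^sub>V\<close> 80) where
  "A \<times>\<^sub>M\<^sub>V B =
    \<lparr>carrier = carrier A \<times> carrier B,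
     mv_plus = (\<lambda>(x, x') (y, y'). (x \<oplus>\<^bsub>A\<^esub> y, x' \<oplus>\<^bsub>B\<^esub> y')),
     mv_neg = (\<lambda>(x, x'). (\<sim>\<^bsub>A\<^esub> x, \<sim>\<^bsub>B\<^esub> x')),
     mv_zero = (\<zero>\<^bsub>A\<^esub>, \<zero>\<^bsub>B\<^esub>)\<rparr>"

text \<open>The Lukasiewicz chain with \<open>n\<close> elements; only meaningful for \<open>n \<ge> 2\<close>.\<close>

definition L :: "nat \<Rightarrow> real mv" where
  "L n =
    \<lparr>carrier = (\<lambda>i. real i / real (n - 1)) ` {0..n - 1},
     mv_plus = (\<lambda>x y. min 1 (x + y)),
     mv_neg = (\<lambda>x. 1 - x),
     mv_zero = 0\<rparr>"

definition mv_of_boolean_algebra :: "'a::boolean_algebra mv" where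
  "mv_of_boolean_algebra = \<lparr>carrier = UNIV, mv_plus = sup, mv_neg = uminus, mv_zero = bot\<rparr>"

text \<open>The four-element Boolean algebra, as the powerset of a two-element set.\<close>

definition B4 :: "bool set mv" where
  "B4 = mv_of_boolean_algebra"


section \<open>Zero-divisor graph and girth\<close>

definition nonzero_zero_divisors :: "('a, 'm) mv_scheme \<Rightarrow> 'a set" where
  "nonzero_zero_divisors A =
    {x \<in> carrier A. x \<noteq> \<zero>\<^bsub>A\<^esub> \<and> (\<exists>y\<in>carrier A. y \<noteq> \<zero>\<^bsub>A\<^esub> \<and> x \<odot>\<^bsub>A\<^esub> y = \<zero>\<^bsub>A\<^esub>)}"

text \<open>
  A simple graph is represented as a symmetric loop-free digraph. The locale for simple graphs in
  \<^theory>\<open>Graph_Theory.Pair_Digraph\<close> is not used, since it requires finitely many vertices.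
\<close>

definition zero_divisor_graph :: "('a, 'm) mv_scheme \<Rightarrow> 'a pair_pre_digraph" where
  "zero_divisor_graph A =
    \<lparr>pverts = nonzero_zero_divisors A,
     parcs = {(x, y). x \<in> nonzero_zero_divisors A \<and> y \<in> nonzero_zero_divisors A \<and>
                      x \<noteq> y \<and> x \<odot>\<^bsub>A\<^esub> y = \<zero>\<^bsub>A\<^esub>}\<rparr>"

text \<open>
  In a symmetric digraph each edge \<open>{u, v}\<close> yields a directed cycle \<open>u, v, u\<close> of length two; the
  bound on the length excludes it. The infimum of the empty set in \<^typ>\<open>enat\<close> is \<open>\<infinity>\<close>.
\<close>

definition girth :: "'a pair_pre_digraph \<Rightarrow> enat" where
  "girth G = (INF p \<in> {p. pre_digraph.cycle (with_proj G) p \<and> length p \<ge> 3}. enat (length p))"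


section \<open>Basic facts\<close>

lemma mv_algebra_L:
  assumes "n \<ge> 2"
  shows "mv_algebra (L n)"
proof -
  have C: "x \<in> carrier (L n) \<longleftrightarrow> (\<exists>i\<le>n - 1. x = real i / real (n - 1))" for x
    by (auto simp: L_def)
  have rng: "0 \<le> x \<and> x \<le> 1" if "x \<in> carrier (L n)" for x
    using that assms by (auto simp: C)
  have plus: "min 1 (x + y) \<in> carrier (L n)"
    if xy: "x \<in> carrier (L n)" "y \<in> carrier (L n)" for x y
  proof -
    from xy obtain i j where ij: "x = real i / real (n - 1)" "y = real j / real (n - 1)"
      by (auto simp: C)
    have s: "x + y = real (i + j) / real (n - 1)"
      by (simp add: ij add_divide_distrib)
    show ?thesis
    proof (cases "i + j \<le> n - 1")
      case True
      then have "x + y \<le> 1"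
        using assms unfolding s by (simp only: divide_le_eq_1 of_nat_le_iff) auto
      then show ?thesis
        using True s by (auto simp: C min_def)
    next
      case False
      then have "x + y \<ge> 1"
        using assms unfolding s by (simp only: le_divide_eq_1 of_nat_le_iff) auto
      then have "min 1 (x + y) = real (n - 1) / real (n - 1)"
        using assms by simp
      then show ?thesis
        unfolding C by (intro exI[of _ "n - 1"]) auto
    qed
  qed
  have neg: "1 - x \<in> carrier (L n)" if x: "x \<in> carrier (L n)" for x
  proof -
    from x obtain i where i: "i \<le> n - 1" "x = real i / real (n - 1)"
      by (auto simp: C)
    have "real (n - 1 - i) = real (n - 1) - real i"
      using i(1) by (rule of_nat_diff)
    moreover have "real (n - 1) \<noteq> 0"
      using assms by auto
    ultimately have "1 - x = real (n - 1 - i) / real (n - 1)"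
      unfolding i(2) by (simp add: diff_divide_distrib)
    then show ?thesis
      unfolding C by (intro exI[of _ "n - 1 - i"]) auto
  qed
  have sel: "mv_plus (L n) = (\<lambda>x y. min 1 (x + y))" "mv_neg (L n) = (\<lambda>x. 1 - x)" "mv_zero (L n) = 0"
    by (simp_all add: L_def)
  show ?thesis
  proof (unfold_locales, goal_cases)
    case 3
    show ?case by (force simp: sel C)
  qed ((simp add: sel plus neg; fail) | (auto simp: sel min_def dest!: rng)[1])+
qed

lemma mv_algebra_of_boolean_algebra:
  "mv_algebra (mv_of_boolean_algebra :: 'a::boolean_algebra mv)"
  by unfold_locales
    (auto simp: mv_of_boolean_algebra_def sup_inf_distrib1 ac_simps)

lemma mv_algebra_B4: "mv_algebra B4"
  unfolding B4_def by (rule mv_algebra_of_boolean_algebra)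

lemma card_carrier_B4: "card (carrier B4) = 4"
  by (simp add: B4_def mv_of_boolean_algebra_def card_Pow flip: Pow_UNIV)

lemma mv_algebra_prod:
  assumes "mv_algebra A" and "mv_algebra B"
  shows "mv_algebra (A \<times>\<^sub>M\<^sub>V B)"
proof -
  interpret A: mv_algebra A by fact
  interpret B: mv_algebra B by fact
  interpret MA: comm_monoid "\<lparr>carrier = carrier A, monoid.mult = mv_plus A, one = mv_zero A\<rparr>"
    by (rule A.plus_comm_monoid)
  interpret MB: comm_monoid "\<lparr>carrier = carrier B, monoid.mult = mv_plus B, one = mv_zero B\<rparr>"
    by (rule B.plus_comm_monoid)
  note monoid = MA.m_closed[simplified] MB.m_closed[simplified]
    MA.one_closed[simplified] MB.one_closed[simplified] MA.m_assoc[simplified] MB.m_assoc[simplified]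
    MA.l_one[simplified] MB.l_one[simplified] MA.r_one[simplified] MB.r_one[simplified]
  show ?thesis
    by unfold_locales
      (auto simp: mv_prod_def monoid A.neg_closed B.neg_closed A.neg_neg B.neg_neg A.plus_neg_zero
        B.plus_neg_zero intro: MA.m_comm[simplified] MB.m_comm[simplified]
        A.plus_neg_swap B.plus_neg_swap)
qed

lemma (in mv_algebra) times_comm:
  assumes "x \<in> carrier A" and "y \<in> carrier A"
  shows "x \<odot> y = y \<odot> x"
proof -
  interpret M: comm_monoid "\<lparr>carrier = carrier A, monoid.mult = mv_plus A, one = mv_zero A\<rparr>"
    by (rule plus_comm_monoid)
  show ?thesis
    using M.m_comm[of "\<sim> x" "\<sim> y"] assms by (simp add: mv_times_def neg_closed)
qed

lemma (in mv_algebra) zero_divisor_graph_simple: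
  "pair_sym_digraph (zero_divisor_graph A)" "pair_loopfree_digraph (zero_divisor_graph A)"
  by unfold_locales
    (auto simp: zero_divisor_graph_def symmetric_def nonzero_zero_divisors_def
      intro!: symI dest: times_comm)

end

theory Submission
  imports Defs
begin

text \<open>
  A triangle in the zero-divisor graph is a triple of distinct nonzero pairwise orthogonal elements.
  If \<open>A\<close> has none and is a chain, it has at most two nonzero elements \<open>x \<le> x\<^sup>*\<close>, hence at most five
  elements. If \<open>A\<close> is not a chain, prelinearity yields disjoint nonzero elements \<open>u\<close>, \<open>v\<close>; then below
  each of them there is at most one further nonzero element, so there are disjoint atoms \<open>a\<close>, \<open>b\<close>.
  They cannot both satisfy \<open>x \<odot> x = 0\<close>, so one of them, say \<open>b\<close>, is Boolean, and every element or its
  negation lies below \<open>b\<^sup>*\<close>, which has at most one element strictly between \<open>0\<close> and itself.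
  Conversely, on a cycle every vertex has two neighbours, and no nonempty set of vertices of the five
  exceptional graphs has this property.
\<close>

section \<open>Order and lattice structure of MV-algebras\<close>

context mv_algebra
begin

section \<open>Derived order, lattice operations and difference\<close>

abbreviation mv_one (\<open>\<^bold>1\<close>) where "\<^bold>1 \<equiv> \<sim> \<zero>"

text \<open>Chosen so that \<open>x \<odot> y = \<zero>\<close> unfolds to
  \<open>x \<preceq> \<sim> y\<close>: adjacency becomes a statement about the order.\<close>

definition le (infix \<open>\<preceq>\<close> 50) where "x \<preceq> y \<longleftrightarrow> \<sim> x \<oplus> y = \<^bold>1"

text \<open>In this form the last MV axiom is literally commutativity of the join.\<close>

definition join (infixl \<open>\<curlyvee>\<close> 65) where "x \<curlyvee> y = \<sim> (\<sim> x \<oplus> y) \<oplus> y"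

definition meet (infixl \<open>\<curlywedge>\<close> 70) where "x \<curlywedge> y = \<sim> (\<sim> x \<curlyvee> \<sim> y)"

text \<open>This is \<open>x \<odot> \<sim> y\<close>, which in the chains \<open>L n\<close> is
  truncated subtraction \<open>max 0 (x - y)\<close>.\<close>

definition diff (infixl \<open>\<ominus>\<close> 65) where "x \<ominus> y = \<sim> (\<sim> x \<oplus> y)"

section \<open>Additive monoid and involution\<close>

lemma plus_closed [simp, intro]: "x \<in> carrier A \<Longrightarrow> y \<in> carrier A \<Longrightarrow> x \<oplus> y \<in> carrier A"
  using comm_monoid.axioms(1)[OF plus_comm_monoid] monoid.m_closed by fastforce

lemma zero_closed [simp, intro]: "\<zero> \<in> carrier A"
  using comm_monoid.axioms(1)[OF plus_comm_monoid] monoid.one_closed by fastforce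

lemma plus_assoc:
  "\<lbrakk>x \<in> carrier A; y \<in> carrier A; z \<in> carrier A\<rbrakk> \<Longrightarrow> x \<oplus> y \<oplus> z = x \<oplus> (y \<oplus> z)"
  using monoid.m_assoc[OF comm_monoid.axioms(1)[OF plus_comm_monoid]] by simp

lemma plus_comm: "\<lbrakk>x \<in> carrier A; y \<in> carrier A\<rbrakk> \<Longrightarrow> x \<oplus> y = y \<oplus> x"
  using comm_monoid.m_comm[OF plus_comm_monoid] by simp

lemma plus_left_comm:
  "\<lbrakk>x \<in> carrier A; y \<in> carrier A; z \<in> carrier A\<rbrakk> \<Longrightarrow> x \<oplus> (y \<oplus> z) = y \<oplus> (x \<oplus> z)"
  by (metis plus_assoc plus_comm)

lemmas plus_ac = plus_assoc plus_comm plus_left_comm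

lemma zero_plus [simp]: "x \<in> carrier A \<Longrightarrow> \<zero> \<oplus> x = x"
  using monoid.l_one[OF comm_monoid.axioms(1)[OF plus_comm_monoid]] by simp

lemma plus_zero [simp]: "x \<in> carrier A \<Longrightarrow> x \<oplus> \<zero> = x"
  using plus_comm zero_plus by simp

lemma plus_one [simp]: "x \<in> carrier A \<Longrightarrow> x \<oplus> \<^bold>1 = \<^bold>1"
  by (rule plus_neg_zero)

declare neg_closed [simp, intro] neg_neg [simp]

lemma one_plus [simp]: "x \<in> carrier A \<Longrightarrow> \<^bold>1 \<oplus> x = \<^bold>1"
  by (simp add: plus_comm)

lemma neg_inject: "\<lbrakk>x \<in> carrier A; y \<in> carrier A\<rbrakk> \<Longrightarrow> \<sim> x = \<sim> y \<longleftrightarrow> x = y"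
  by (metis neg_neg)

lemma neg_eq_one_iff [simp]: "x \<in> carrier A \<Longrightarrow> \<sim> x = \<^bold>1 \<longleftrightarrow> x = \<zero>"
  by (simp add: neg_inject)

lemma one_eq_neg_iff [simp]: "x \<in> carrier A \<Longrightarrow> \<^bold>1 = \<sim> x \<longleftrightarrow> x = \<zero>"
  using neg_eq_one_iff by metis

lemma neg_eq_zero_iff: "x \<in> carrier A \<Longrightarrow> \<sim> x = \<zero> \<longleftrightarrow> x = \<^bold>1"
  by (metis neg_neg zero_closed)

text \<open>The swap axiom with the top element as second argument: one side is absorbed into the
  top, the other reduces to \<open>\<sim> x \<oplus> x\<close>.\<close>

lemma neg_plus_self: "x \<in> carrier A \<Longrightarrow> \<sim> x \<oplus> x = \<^bold>1"
  using plus_neg_swap[of x "\<^bold>1"] by simp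

lemma plus_neg_self: "x \<in> carrier A \<Longrightarrow> x \<oplus> \<sim> x = \<^bold>1"
  using neg_plus_self[of x] by (simp add: plus_comm)

lemma times_eq_zero_iff:
  "\<lbrakk>x \<in> carrier A; y \<in> carrier A\<rbrakk> \<Longrightarrow> x \<odot> y = \<zero> \<longleftrightarrow> x \<preceq> \<sim> y"
  by (simp add: mv_times_def le_def neg_eq_zero_iff)

lemma join_closed [simp, intro]: "\<lbrakk>x \<in> carrier A; y \<in> carrier A\<rbrakk> \<Longrightarrow> x \<curlyvee> y \<in> carrier A"
  by (simp add: join_def)

lemma meet_closed [simp, intro]: "\<lbrakk>x \<in> carrier A; y \<in> carrier A\<rbrakk> \<Longrightarrow> x \<curlywedge> y \<in> carrier A"
  by (simp add: meet_def)

lemma diff_closed [simp, intro]: "\<lbrakk>x \<in> carrier A; y \<in> carrier A\<rbrakk> \<Longrightarrow> x \<ominus> y \<in> carrier A"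
  by (simp add: diff_def)

section \<open>The natural order\<close>

lemma le_refl [simp]: "x \<in> carrier A \<Longrightarrow> x \<preceq> x"
  by (simp add: le_def neg_plus_self)

lemma zero_le [simp]: "x \<in> carrier A \<Longrightarrow> \<zero> \<preceq> x"
  by (simp add: le_def)

lemma le_one [simp]: "x \<in> carrier A \<Longrightarrow> x \<preceq> \<^bold>1"
  by (simp add: le_def)

lemma join_comm: "\<lbrakk>x \<in> carrier A; y \<in> carrier A\<rbrakk> \<Longrightarrow> x \<curlyvee> y = y \<curlyvee> x"
  by (simp add: join_def plus_neg_swap)

lemma join_absorb: "\<lbrakk>x \<in> carrier A; y \<in> carrier A; x \<preceq> y\<rbrakk> \<Longrightarrow> x \<curlyvee> y = y"
  by (simp add: join_def le_def)

lemma le_antisym: "\<lbrakk>x \<preceq> y; y \<preceq> x; x \<in> carrier A; y \<in> carrier A\<rbrakk> \<Longrightarrow> x = y"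
  by (metis join_comm join_absorb)

lemma le_zero_iff [simp]: "x \<in> carrier A \<Longrightarrow> x \<preceq> \<zero> \<longleftrightarrow> x = \<zero>"
  using le_antisym zero_le by blast

lemma le_plus: "\<lbrakk>x \<in> carrier A; y \<in> carrier A\<rbrakk> \<Longrightarrow> x \<preceq> x \<oplus> y"
  by (simp add: le_def neg_plus_self flip: plus_assoc)

lemma diff_plus: "\<lbrakk>x \<in> carrier A; y \<in> carrier A\<rbrakk> \<Longrightarrow> y \<ominus> x \<oplus> x = y \<curlyvee> x"
  by (simp add: join_def diff_def)

lemma plus_diff: "\<lbrakk>x \<in> carrier A; y \<in> carrier A\<rbrakk> \<Longrightarrow> x \<oplus> (y \<ominus> x) = x \<curlyvee> y"
  using diff_plus join_comm plus_comm by simp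

text \<open>The witness is \<open>y \<ominus> x\<close>, since adding it to \<open>x\<close> gives
  the join. Reading the order as divisibility in the additive monoid makes transitivity and
  monotonicity of addition immediate.\<close>

lemma le_iff_plus:
  "\<lbrakk>x \<in> carrier A; y \<in> carrier A\<rbrakk> \<Longrightarrow> x \<preceq> y \<longleftrightarrow> (\<exists>z\<in>carrier A. y = x \<oplus> z)"
  by (metis diff_closed join_absorb plus_diff le_plus)

lemma le_trans:
  "\<lbrakk>x \<preceq> y; y \<preceq> z; x \<in> carrier A; y \<in> carrier A; z \<in> carrier A\<rbrakk> \<Longrightarrow> x \<preceq> z"
  by (auto simp: le_iff_plus plus_assoc)

lemma plus_mono:
  assumes "x \<preceq> y" "x' \<preceq> y'" "x \<in> carrier A" "y \<in> carrier A" "x' \<in> carrier A" "y' \<in> carrier A"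
  shows "x \<oplus> x' \<preceq> y \<oplus> y'"
proof -
  obtain z z' where "z \<in> carrier A" "z' \<in> carrier A" "y = x \<oplus> z" "y' = x' \<oplus> z'"
    using assms by (auto simp: le_iff_plus)
  then have "y \<oplus> y' = (x \<oplus> x') \<oplus> (z \<oplus> z')"
    using assms by (simp add: plus_ac)
  then show ?thesis
    using assms \<open>z \<in> carrier A\<close> \<open>z' \<in> carrier A\<close> le_plus by simp
qed

lemma neg_le_neg_iff:
  "\<lbrakk>x \<in> carrier A; y \<in> carrier A\<rbrakk> \<Longrightarrow> \<sim> x \<preceq> \<sim> y \<longleftrightarrow> y \<preceq> x"
  by (simp add: le_def plus_comm)

lemma le_neg_swap: "\<lbrakk>x \<in> carrier A; y \<in> carrier A\<rbrakk> \<Longrightarrow> x \<preceq> \<sim> y \<longleftrightarrow> y \<preceq> \<sim> x"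
  by (simp add: le_def plus_comm)

lemma neg_le_swap: "\<lbrakk>x \<in> carrier A; y \<in> carrier A\<rbrakk> \<Longrightarrow> \<sim> x \<preceq> y \<longleftrightarrow> \<sim> y \<preceq> x"
  by (simp add: le_def plus_comm)

section \<open>Truncated difference\<close>

text \<open>Residuation: by associativity both sides are the same equation. Several of the rules for
  the difference below are instances.\<close>

lemma diff_le_iff:
  "\<lbrakk>x \<in> carrier A; y \<in> carrier A; z \<in> carrier A\<rbrakk> \<Longrightarrow> x \<ominus> y \<preceq> z \<longleftrightarrow> x \<preceq> y \<oplus> z"
  by (simp add: le_def diff_def plus_assoc)

lemma diff_eq_zero_iff: "\<lbrakk>x \<in> carrier A; y \<in> carrier A\<rbrakk> \<Longrightarrow> x \<ominus> y = \<zero> \<longleftrightarrow> x \<preceq> y"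
  by (metis diff_closed diff_le_iff le_zero_iff plus_zero zero_closed)

lemma diff_diff:
  "\<lbrakk>x \<in> carrier A; y \<in> carrier A; z \<in> carrier A\<rbrakk> \<Longrightarrow> x \<ominus> y \<ominus> z = x \<ominus> (y \<oplus> z)"
  by (simp add: diff_def plus_assoc)

lemma diff_mono:
  "\<lbrakk>x \<preceq> x'; y' \<preceq> y; x \<in> carrier A; y \<in> carrier A; x' \<in> carrier A; y' \<in> carrier A\<rbrakk>
    \<Longrightarrow> x \<ominus> y \<preceq> x' \<ominus> y'"
  by (simp add: diff_def neg_le_neg_iff plus_mono)

lemma diff_le: "\<lbrakk>x \<in> carrier A; y \<in> carrier A\<rbrakk> \<Longrightarrow> x \<ominus> y \<preceq> x"
  by (simp add: diff_le_iff le_plus plus_comm[of y x])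

lemma diff_le_neg: "\<lbrakk>x \<in> carrier A; y \<in> carrier A\<rbrakk> \<Longrightarrow> x \<ominus> y \<preceq> \<sim> y"
  by (simp add: diff_le_iff plus_neg_self)

section \<open>Lattice bounds and cancellation\<close>

lemma le_join2: "\<lbrakk>x \<in> carrier A; y \<in> carrier A\<rbrakk> \<Longrightarrow> y \<preceq> x \<curlyvee> y"
  by (simp add: join_def le_plus plus_comm[of _ y])

lemma le_join1: "\<lbrakk>x \<in> carrier A; y \<in> carrier A\<rbrakk> \<Longrightarrow> x \<preceq> x \<curlyvee> y"
  by (metis join_comm le_join2)

lemma join_least:
  assumes "x \<preceq> z" "y \<preceq> z" "x \<in> carrier A" "y \<in> carrier A" "z \<in> carrier A"
  shows "x \<curlyvee> y \<preceq> z"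
proof -
  \<comment> \<open>The left side is \<open>x \<curlyvee> y\<close>; the right side is
    \<open>z \<curlyvee> y\<close>, which is \<open>z\<close> because
    \<open>y \<preceq> z\<close>.\<close>
  have "x \<ominus> y \<oplus> y \<preceq> z \<ominus> y \<oplus> y"
    using assms by (simp add: plus_mono diff_mono)
  then show ?thesis
    using assms by (metis diff_plus join_absorb join_comm)
qed

lemma meet_comm: "\<lbrakk>x \<in> carrier A; y \<in> carrier A\<rbrakk> \<Longrightarrow> x \<curlywedge> y = y \<curlywedge> x"
  by (simp add: meet_def join_comm)

lemma meet_le1: "\<lbrakk>x \<in> carrier A; y \<in> carrier A\<rbrakk> \<Longrightarrow> x \<curlywedge> y \<preceq> x"
  by (metis meet_def join_closed le_join1 neg_closed neg_le_swap)

lemma meet_le2: "\<lbrakk>x \<in> carrier A; y \<in> carrier A\<rbrakk> \<Longrightarrow> x \<curlywedge> y \<preceq> y"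
  by (metis meet_comm meet_le1)

lemma meet_greatest:
  "\<lbrakk>z \<preceq> x; z \<preceq> y; x \<in> carrier A; y \<in> carrier A; z \<in> carrier A\<rbrakk> \<Longrightarrow> z \<preceq> x \<curlywedge> y"
  by (simp add: meet_def le_neg_swap[of z] join_least neg_le_neg_iff)

lemma diff_diff_self: "\<lbrakk>x \<in> carrier A; y \<in> carrier A\<rbrakk> \<Longrightarrow> x \<ominus> (x \<ominus> y) = x \<curlywedge> y"
  by (subst meet_comm) (simp_all add: meet_def join_def diff_def plus_comm)

text \<open>Adding \<open>x\<close> and subtracting it again keeps only the part of \<open>y\<close>
  that fits below \<open>\<sim> x\<close>; the rest is lost to truncation.\<close>

lemma plus_diff_cancel:
  "\<lbrakk>x \<in> carrier A; y \<in> carrier A\<rbrakk> \<Longrightarrow> x \<oplus> y \<ominus> x = y \<curlywedge> \<sim> x"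
  by (simp add: meet_def join_def diff_def plus_comm)

text \<open>Subtracting \<open>x\<close> from the sum loses nothing of a summand that lies below
  \<open>\<sim> x\<close>.\<close>

lemma plus_left_cancel:
  assumes "x \<oplus> y = x \<oplus> z" "y \<preceq> \<sim> x" "z \<preceq> \<sim> x" "x \<in> carrier A" "y \<in> carrier A" "z \<in> carrier A"
  shows "y = z"
proof -
  have "y \<curlywedge> \<sim> x = z \<curlywedge> \<sim> x"
    using assms by (metis plus_diff_cancel)
  moreover have "y \<curlywedge> \<sim> x = y" "z \<curlywedge> \<sim> x = z"
    using assms by (meson le_antisym le_refl meet_closed meet_greatest meet_le1 neg_closed)+
  ultimately show ?thesis
    by simp
qed

section \<open>Prelinearity, disjointness and Boolean elements\<close>

text \<open>Taking \<open>p\<close> from \<open>x\<close> and \<open>q\<close> from \<open>y\<close>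
  leaves the same remainder \<open>x \<curlywedge> y\<close>. Putting \<open>p\<close> back gives
  \<open>x\<close>, and \<open>p\<close> is below \<open>q \<oplus> (p \<ominus> q)\<close>, so
  \<open>x\<close> is below \<open>y \<oplus> (p \<ominus> q)\<close>. By residuation
  \<open>p \<preceq> p \<ominus> q\<close>, which says that the meet vanishes.\<close>

lemma meet_diff_diff_eq_zero:
  assumes [simp]: "x \<in> carrier A" "y \<in> carrier A"
  shows "(x \<ominus> y) \<curlywedge> (y \<ominus> x) = \<zero>"
proof -
  define p q where "p = x \<ominus> y" and "q = y \<ominus> x"
  have [simp]: "p \<in> carrier A" "q \<in> carrier A"
    by (simp_all add: p_def q_def)
  have yq: "y \<ominus> q = x \<ominus> p"
    by (simp add: p_def q_def diff_diff_self meet_comm)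
  have "x = x \<ominus> p \<oplus> p"
    by (metis diff_closed diff_le diff_plus join_absorb join_comm p_def assms)
  also have "\<dots> \<preceq> x \<ominus> p \<oplus> (p \<curlyvee> q)"
    by (simp add: plus_mono le_join1)
  also have "\<dots> = y \<ominus> q \<oplus> q \<oplus> (p \<ominus> q)"
    by (simp add: yq join_comm[of p] plus_assoc plus_diff)
  also have "y \<ominus> q \<oplus> q = y"
    by (metis diff_closed diff_le diff_plus join_absorb join_comm q_def assms)
  finally have "x \<ominus> (y \<oplus> (p \<ominus> q)) = \<zero>"
    by (simp add: diff_eq_zero_iff)
  then have "p \<ominus> (p \<ominus> q) = \<zero>"
    by (simp add: p_def diff_diff)
  then show ?thesis
    by (simp add: diff_diff_self p_def q_def)
qed

text \<open>The product \<open>x \<odot> y\<close>, written as \<open>x \<ominus> \<sim> y\<close>,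
  lies below both factors. The converse fails: the middle element of \<open>L 3\<close> is
  orthogonal to itself.\<close>

lemma meet_eq_zero_imp_le_neg:
  assumes "x \<curlywedge> y = \<zero>" "x \<in> carrier A" "y \<in> carrier A"
  shows "x \<preceq> \<sim> y"
proof -
  have "x \<ominus> \<sim> y \<preceq> x \<curlywedge> y"
    using assms(2,3) diff_le_neg[of x "\<sim> y"] by (intro meet_greatest diff_le) simp_all
  then show ?thesis
    using assms by (simp add: diff_eq_zero_iff)
qed

lemma meet_eq_zero_mono:
  assumes "x \<curlywedge> y = \<zero>" "x' \<preceq> x" "y' \<preceq> y"
    "x \<in> carrier A" "y \<in> carrier A" "x' \<in> carrier A" "y' \<in> carrier A"
  shows "x' \<curlywedge> y' = \<zero>"
proof -
  have "x' \<curlywedge> y' \<preceq> x \<curlywedge> y"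
    using assms by (meson le_trans meet_closed meet_greatest meet_le1 meet_le2)
  then show ?thesis
    using assms by simp
qed

lemma one_neq_zero: "\<lbrakk>x \<in> carrier A; x \<noteq> \<zero>\<rbrakk> \<Longrightarrow> \<^bold>1 \<noteq> \<zero>"
  by (metis plus_one plus_zero)

text \<open>This and the converse below rest on
  \<open>b \<oplus> b \<ominus> b = b \<curlywedge> \<sim> b\<close>: the additive idempotents are
  the Boolean elements.\<close>

lemma idem_imp_meet_neg:
  assumes "b \<oplus> b = b" "b \<in> carrier A"
  shows "b \<curlywedge> \<sim> b = \<zero>"
  using assms by (metis diff_eq_zero_iff le_refl plus_diff_cancel)

lemma meet_neg_imp_idem:
  assumes "b \<curlywedge> \<sim> b = \<zero>" "b \<in> carrier A"
  shows "b \<oplus> b = b"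
proof -
  have "b \<oplus> b \<ominus> b = \<zero>"
    using assms by (simp add: plus_diff_cancel)
  then show ?thesis
    using assms by (intro le_antisym) (simp_all add: diff_eq_zero_iff le_plus)
qed

end

section \<open>Recognising the exceptional algebras\<close>

lemma carrier_L:
  "carrier (L 2) = {0, 1}" "carrier (L 3) = {0, 1/2, 1}" "carrier (L 4) = {0, 1/3, 2/3, 1}"
  "carrier (L 5) = {0, 1/4, 1/2, 3/4, 1}"
  by (auto simp: L_def image_iff numeral_eq_Suc atLeast0_atMost_Suc)

context mv_algebra
begin

lemma iso_L3:
  assumes "carrier A = {\<zero>, a, \<^bold>1}" "a \<noteq> \<zero>" "\<sim> a = a"
  shows "A \<cong>\<^sub>M\<^sub>V L 3"
proof -
  have [simp]: "a \<in> carrier A"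
    using assms by simp
  have distinct: "\<^bold>1 \<noteq> \<zero>" "a \<noteq> \<zero>" "a \<noteq> \<^bold>1"
    using assms one_neq_zero[of a] by auto
  have table: "a \<oplus> a = \<^bold>1"
    using assms plus_neg_self[of a] by simp
  define f where "f x = (if x = \<zero> then 0 else if x = a then 1/2 else 1 :: real)" for x
  have f: "f \<zero> = 0" "f a = 1/2" "f \<^bold>1 = 1"
    using distinct by (auto simp: f_def)
  have "bij_betw f (carrier A) (carrier (L 3))"
    unfolding assms(1) carrier_L using distinct by (auto simp: bij_betw_def f)
  moreover have "\<forall>x\<in>carrier A. \<forall>y\<in>carrier A. f (x \<oplus> y) = min 1 (f x + f y)"
    unfolding assms(1) by (simp add: f table)
  moreover have "\<forall>x\<in>carrier A. f (\<sim> x) = 1 - f x"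
    unfolding assms(1) by (simp add: f assms(3))
  ultimately show ?thesis
    unfolding mv_iso_def by (intro exI[of _ f]) (auto simp: L_def f)
qed

text \<open>By elimination: \<open>a \<oplus> a\<close> can be neither zero, nor \<open>a\<close> by
  cancellation, nor the top since that would give \<open>\<sim> a \<preceq> a\<close>. Only
  \<open>\<sim> a\<close> remains, which fixes the addition table.\<close>

lemma iso_L4:
  assumes "carrier A = {\<zero>, a, \<sim> a, \<^bold>1}" "a \<noteq> \<zero>" "\<sim> a \<noteq> a" "a \<preceq> \<sim> a"
  shows "A \<cong>\<^sub>M\<^sub>V L 4"
proof -
  have [simp]: "a \<in> carrier A"
    using assms by simp
  have distinct: "\<^bold>1 \<noteq> \<zero>" "a \<noteq> \<zero>" "a \<noteq> \<^bold>1" "\<sim> a \<noteq> \<zero>" "\<sim> a \<noteq> a" "\<sim> a \<noteq> \<^bold>1"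
    using assms one_neq_zero[of a] by (auto simp: neg_eq_zero_iff)
  have "a \<oplus> a \<noteq> \<zero>"
    using le_plus[of a a] assms(2) by auto
  moreover have "a \<oplus> a \<noteq> a"
    using plus_left_cancel[of a a \<zero>] assms by auto
  moreover have "a \<oplus> a \<noteq> \<^bold>1"
    using le_antisym[of a "\<sim> a"] assms by (auto simp: le_def)
  ultimately have "a \<oplus> a = \<sim> a"
    using plus_closed[of a a] assms(1) by auto
  moreover have "\<sim> a \<oplus> \<sim> a = \<^bold>1"
    using assms(4) by (simp add: le_def)
  ultimately have table: "a \<oplus> a = \<sim> a" "a \<oplus> \<sim> a = \<^bold>1" "\<sim> a \<oplus> a = \<^bold>1" "\<sim> a \<oplus> \<sim> a = \<^bold>1"
    by (simp_all add: plus_neg_self neg_plus_self)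
  define f where
    "f x = (if x = \<zero> then 0 else if x = a then 1/3 else if x = \<sim> a then 2/3 else 1 :: real)" for x
  have f: "f \<zero> = 0" "f a = 1/3" "f (\<sim> a) = 2/3" "f \<^bold>1 = 1"
    using distinct by (auto simp: f_def)
  have "bij_betw f (carrier A) (carrier (L 4))"
    unfolding assms(1) carrier_L using distinct by (auto simp: bij_betw_def f)
  moreover have "\<forall>x\<in>carrier A. \<forall>y\<in>carrier A. f (x \<oplus> y) = min 1 (f x + f y)"
    unfolding assms(1) by (simp add: f table)
  moreover have "\<forall>x\<in>carrier A. f (\<sim> x) = 1 - f x"
    unfolding assms(1) by (simp add: f)
  ultimately show ?thesis
    unfolding mv_iso_def by (intro exI[of _ f]) (auto simp: L_def f)
qed

text \<open>The elements increase from \<open>a\<close> through the self-negated \<open>b\<close> to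
  \<open>\<sim> a\<close>. This leaves one value for \<open>a \<oplus> b\<close>, and then
  cancellation leaves one for \<open>a \<oplus> a\<close>.\<close>

lemma iso_L5:
  assumes "carrier A = {\<zero>, a, b, \<sim> a, \<^bold>1}" "a \<noteq> \<zero>" "a \<noteq> b" "a \<preceq> b" "\<sim> b = b"
  shows "A \<cong>\<^sub>M\<^sub>V L 5"
proof -
  have [simp]: "a \<in> carrier A" "b \<in> carrier A"
    using assms by simp_all
  have "b \<preceq> \<sim> a"
    using assms(4,5) neg_le_neg_iff[of b a] by simp
  then have "a \<preceq> \<sim> a"
    using assms(4) le_trans[of a b "\<sim> a"] by simp
  have nle: "\<not> b \<preceq> a"
    using assms le_antisym[of a b] by auto
  have "b \<noteq> \<zero>"
    using assms by auto
  then have distinct: "\<^bold>1 \<noteq> \<zero>" "a \<noteq> \<zero>" "a \<noteq> \<^bold>1" "b \<noteq> \<zero>" "b \<noteq> a" "b \<noteq> \<^bold>1"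
    "\<sim> a \<noteq> \<zero>" "\<sim> a \<noteq> a" "\<sim> a \<noteq> b" "\<sim> a \<noteq> \<^bold>1"
    using assms one_neq_zero[of a] nle \<open>b \<preceq> \<sim> a\<close> neg_neg[of a] neg_neg[of b] by auto
  \<comment> \<open>If the sum were the top, then \<open>\<sim> a \<preceq> b\<close>, hence
    \<open>b = \<sim> b \<preceq> a\<close>.\<close>
  have "a \<oplus> b \<noteq> \<^bold>1"
    using nle assms(5) neg_le_swap[of a b] by (auto simp: le_def)
  \<comment> \<open>Rules out zero and \<open>a\<close> as values of the sum, as \<open>b\<close> is
    below neither.\<close>
  moreover have "b \<preceq> a \<oplus> b"
    using le_plus[of b a] by (simp add: plus_comm)
  moreover have "a \<oplus> b \<noteq> b"
    using plus_left_cancel[of b a \<zero>] assms by (auto simp: plus_comm)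
  ultimately have ab: "a \<oplus> b = \<sim> a"
    using plus_closed[of a b] assms(1) distinct nle by auto
  have "a \<oplus> a \<noteq> \<zero>"
    using le_plus[of a a] assms(2) by auto
  moreover have "a \<oplus> a \<noteq> a"
    using plus_left_cancel[of a a \<zero>] assms(2) \<open>a \<preceq> \<sim> a\<close> by auto
  moreover have "a \<oplus> a \<noteq> \<^bold>1"
    using le_antisym[of a "\<sim> a"] \<open>a \<preceq> \<sim> a\<close> distinct by (auto simp: le_def)
  moreover have "a \<oplus> a \<noteq> \<sim> a"
    using plus_left_cancel[of a a b] ab assms(3) \<open>a \<preceq> \<sim> a\<close> \<open>b \<preceq> \<sim> a\<close> by auto
  ultimately have aa: "a \<oplus> a = b"
    using plus_closed[of a a] assms(1) by auto
  have "\<sim> a \<oplus> b = \<^bold>1" "\<sim> a \<oplus> \<sim> a = \<^bold>1" "b \<oplus> b = \<^bold>1"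
    using assms(4,5) \<open>a \<preceq> \<sim> a\<close> plus_neg_self[of b] by (simp_all add: le_def)
  then have table: "a \<oplus> a = b" "a \<oplus> b = \<sim> a" "b \<oplus> a = \<sim> a" "b \<oplus> b = \<^bold>1"
    "a \<oplus> \<sim> a = \<^bold>1" "\<sim> a \<oplus> a = \<^bold>1" "b \<oplus> \<sim> a = \<^bold>1" "\<sim> a \<oplus> b = \<^bold>1" "\<sim> a \<oplus> \<sim> a = \<^bold>1"
    using aa ab plus_comm[of b a] plus_comm[of b "\<sim> a"] by (simp_all add: plus_neg_self neg_plus_self)
  define f where
    "f x = (if x = \<zero> then 0 else if x = a then 1/4 else if x = b then 1/2
      else if x = \<sim> a then 3/4 else 1 :: real)" for x
  have f: "f \<zero> = 0" "f a = 1/4" "f b = 1/2" "f (\<sim> a) = 3/4" "f \<^bold>1 = 1"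
    using distinct by (auto simp: f_def)
  have "bij_betw f (carrier A) (carrier (L 5))"
    unfolding assms(1) carrier_L using distinct by (auto simp: bij_betw_def f)
  moreover have "\<forall>x\<in>carrier A. \<forall>y\<in>carrier A. f (x \<oplus> y) = min 1 (f x + f y)"
    unfolding assms(1) by (simp add: f table)
  moreover have "\<forall>x\<in>carrier A. f (\<sim> x) = 1 - f x"
    unfolding assms(1) by (simp add: f assms(5))
  ultimately show ?thesis
    unfolding mv_iso_def by (intro exI[of _ f]) (auto simp: L_def f)
qed

text \<open>Disjointness of \<open>b\<close> and \<open>\<sim> b\<close> makes both idempotent,
  which completes the addition table.\<close>

lemma iso_B4:
  assumes "carrier A = {\<zero>, b, \<sim> b, \<^bold>1}" "b \<noteq> \<zero>" "\<sim> b \<noteq> \<zero>" "b \<curlywedge> \<sim> b = \<zero>"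
  shows "A \<cong>\<^sub>M\<^sub>V B4"
proof -
  have [simp]: "b \<in> carrier A"
    using assms by simp
  have idem: "b \<oplus> b = b" "\<sim> b \<oplus> \<sim> b = \<sim> b"
    using assms meet_neg_imp_idem[of b] meet_neg_imp_idem[of "\<sim> b"] by (simp_all add: meet_comm)
  have "b \<noteq> \<^bold>1"
    using assms by auto
  then have distinct: "\<^bold>1 \<noteq> \<zero>" "b \<noteq> \<zero>" "b \<noteq> \<^bold>1" "\<sim> b \<noteq> \<zero>" "\<sim> b \<noteq> b" "\<sim> b \<noteq> \<^bold>1"
    using assms idem one_neq_zero[of b] plus_neg_self[of b] by auto
  define f where
    "f x = (if x = \<zero> then {} else if x = b then {True} else if x = \<sim> b then {False} else UNIV)" for x
  have f: "f \<zero> = {}" "f b = {True}" "f (\<sim> b) = {False}" "f \<^bold>1 = UNIV"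
    using distinct by (auto simp: f_def)
  \<comment> \<open>The universe of \<open>bool set\<close> is enumerated as the powerset of the two
    truth values.\<close>
  have C: "carrier B4 = {{}, {True}, {False}, UNIV}"
    using Pow_UNIV[where ?'a = bool]
    by (auto simp: B4_def mv_of_boolean_algebra_def UNIV_bool Pow_insert insert_commute)
  have "bij_betw f (carrier A) (carrier B4)"
    unfolding assms(1) C using distinct by (auto simp: bij_betw_def f)
  moreover have "\<forall>x\<in>carrier A. \<forall>y\<in>carrier A. f (x \<oplus> y) = f x \<union> f y"
    unfolding assms(1)
    by (auto simp: f idem plus_neg_self neg_plus_self)
  moreover have "\<forall>x\<in>carrier A. f (\<sim> x) = - f x"
    unfolding assms(1) by (auto simp: f)
  ultimately show ?thesis
    unfolding mv_iso_def
    by (intro exI[of _ f]) (auto simp: B4_def mv_of_boolean_algebra_def f)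
qed

text \<open>In coordinates \<open>b = (1, 0)\<close>, \<open>\<sim> b = (0, 1)\<close>,
  \<open>w = (0, 1/2)\<close> and \<open>\<sim> w = (1, 1/2)\<close>. All other sums follow from the
  two given ones and the idempotence of \<open>b\<close> and \<open>\<sim> b\<close>.\<close>

lemma iso_L2_L3:
  assumes carrier: "carrier A = {\<zero>, w, \<sim> b, b, \<sim> w, \<^bold>1}"
    and nz: "w \<noteq> \<zero>" "b \<noteq> \<zero>" "w \<noteq> \<sim> b"
    and idem: "b \<curlywedge> \<sim> b = \<zero>" and ww: "w \<oplus> w = \<sim> b" and bw: "b \<oplus> w = \<sim> w"
  shows "A \<cong>\<^sub>M\<^sub>V L 2 \<times>\<^sub>M\<^sub>V L 3"
proof -
  define c where "c = \<sim> b"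
  have [simp]: "b \<in> carrier A" "w \<in> carrier A" "c \<in> carrier A"
    using assms c_def by simp_all
  have "w \<preceq> c"
    using ww le_plus[of w w] by (simp add: c_def)
  have bb: "b \<oplus> b = b" and cc: "c \<oplus> c = c"
    using idem meet_neg_imp_idem[of b] meet_neg_imp_idem[of "\<sim> b"]
    by (simp_all add: meet_comm c_def)
  have wc: "w \<oplus> c = c"
    using plus_mono[of w c c c] \<open>w \<preceq> c\<close> le_plus[of c w]
    by (intro le_antisym) (simp_all add: cc plus_comm)
  have bc: "b \<oplus> c = \<^bold>1"
    by (simp add: c_def plus_neg_self)
  have bw': "b \<oplus> \<sim> w = \<sim> w"
    using plus_assoc[of b b w] by (simp add: bb bw)
  have ww': "\<sim> w \<oplus> \<sim> w = \<^bold>1"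
  proof -
    have "\<sim> w \<oplus> \<sim> w = (b \<oplus> b) \<oplus> (w \<oplus> w)"
      by (simp only: bw[symmetric]) (simp add: plus_ac)
    then show ?thesis
      by (simp add: bb ww bc flip: c_def)
  qed
  have cw': "\<sim> w \<oplus> c = \<^bold>1"
    using \<open>w \<preceq> c\<close> by (simp add: le_def)
  have table: "w \<oplus> w = c" "w \<oplus> c = c" "c \<oplus> w = c" "w \<oplus> b = \<sim> w" "b \<oplus> w = \<sim> w"
    "w \<oplus> \<sim> w = \<^bold>1" "\<sim> w \<oplus> w = \<^bold>1" "c \<oplus> c = c" "c \<oplus> b = \<^bold>1" "b \<oplus> c = \<^bold>1"
    "c \<oplus> \<sim> w = \<^bold>1" "\<sim> w \<oplus> c = \<^bold>1" "b \<oplus> b = b" "b \<oplus> \<sim> w = \<sim> w" "\<sim> w \<oplus> b = \<sim> w"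
    "\<sim> w \<oplus> \<sim> w = \<^bold>1"
    using ww wc bw bc bw' ww' cw' bb cc plus_comm[of c w] plus_comm[of w b] plus_comm[of c b]
      plus_comm[of c "\<sim> w"] plus_comm[of "\<sim> w" b] plus_neg_self[of w] neg_plus_self[of w]
    by (simp_all flip: c_def)
  have neg: "\<sim> b = c" "\<sim> c = b"
    by (simp_all add: c_def)
  have "c \<noteq> \<zero>"
    using \<open>w \<preceq> c\<close> nz by auto
  moreover have "c \<noteq> \<^bold>1"
    using nz by (simp add: c_def)
  moreover have "b \<noteq> \<^bold>1"
    using \<open>c \<noteq> \<zero>\<close> by (auto simp: c_def)
  moreover have "w \<noteq> \<^bold>1"
    using table(2) \<open>c \<noteq> \<^bold>1\<close> by auto
  moreover have "\<sim> w \<noteq> \<zero>"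
    using \<open>w \<noteq> \<^bold>1\<close> neg_eq_zero_iff[of w] by auto
  moreover have "\<sim> w \<noteq> \<^bold>1"
    using nz by simp
  moreover have "w \<noteq> c" "b \<noteq> \<sim> w"
    using nz neg by (auto simp: neg_inject)
  \<comment> \<open>For this and the next three pairs, an equality would give one sum two different
    values in \<open>table\<close>.\<close>
  moreover have "w \<noteq> b"
    using table bb \<open>w \<noteq> c\<close> by auto
  moreover have "w \<noteq> \<sim> w"
    using table \<open>c \<noteq> \<^bold>1\<close> by metis
  moreover have "c \<noteq> b"
    using table \<open>c \<noteq> \<^bold>1\<close> by metis
  moreover have "c \<noteq> \<sim> w"
    using table \<open>\<sim> w \<noteq> \<^bold>1\<close> by metis
  ultimately have distinct: "distinct [\<zero>, w, c, b, \<sim> w, \<^bold>1]"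
    using nz one_neq_zero[of w] by auto
  have C: "carrier (L 2 \<times>\<^sub>M\<^sub>V L 3) = {(0, 0), (0, 1/2), (0, 1), (1, 0), (1, 1/2), (1, 1)}"
    by (auto simp: mv_prod_def carrier_L)
  define f where
    "f x = (if x = \<zero> then (0, 0) else if x = w then (0, 1/2) else if x = c then (0, 1)
      else if x = b then (1, 0) else if x = \<sim> w then (1, 1/2) else (1, 1) :: real \<times> real)" for x
  have f: "f \<zero> = (0, 0)" "f w = (0, 1/2)" "f c = (0, 1)" "f b = (1, 0)" "f (\<sim> w) = (1, 1/2)"
    "f \<^bold>1 = (1, 1)"
    using distinct by (auto simp: f_def)
  have carrier': "carrier A = {\<zero>, w, c, b, \<sim> w, \<^bold>1}"
    using carrier by (simp add: c_def)
  have "bij_betw f (carrier A) (carrier (L 2 \<times>\<^sub>M\<^sub>V L 3))"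
    unfolding carrier' C by (auto simp: bij_betw_def f)
  moreover have "\<forall>x\<in>carrier A. \<forall>y\<in>carrier A. f (x \<oplus> y) = f x \<oplus>\<^bsub>L 2 \<times>\<^sub>M\<^sub>V L 3\<^esub> f y"
    unfolding carrier' by (simp add: f table mv_prod_def L_def)
  moreover have "\<forall>x\<in>carrier A. f (\<sim> x) = \<sim>\<^bsub>L 2 \<times>\<^sub>M\<^sub>V L 3\<^esub> f x"
    unfolding carrier' by (simp add: f neg mv_prod_def L_def)
  ultimately show ?thesis
    unfolding mv_iso_def by (intro exI[of _ f]) (auto simp: mv_prod_def L_def f)
qed

end

section \<open>Triangle-free MV-algebras\<close>

text \<open>The classification in this locale is used by contraposition: an algebra outside the list
  violates the axiom, and a violation is a triangle. The disjunctive conclusion serves to force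
  elements to coincide.\<close>

locale triangle_free_mv_algebra = mv_algebra +
  assumes triangle_free:
    "\<lbrakk>x \<in> carrier A; y \<in> carrier A; z \<in> carrier A; x \<noteq> \<zero>; y \<noteq> \<zero>; z \<noteq> \<zero>;
      x \<preceq> \<sim> y; y \<preceq> \<sim> z; x \<preceq> \<sim> z\<rbrakk> \<Longrightarrow> x = y \<or> y = z \<or> x = z"
begin

text \<open>
  The nonzero elements \<open>x \<preceq> \<sim> x\<close> of a chain are pairwise orthogonal, so there are at most two of
  them, and every element other than \<open>\<zero>\<close> and \<open>\<^bold>1\<close> is one of them or the negation of one of them.
\<close>

lemma chain_iso:
  assumes total: "\<And>x y. \<lbrakk>x \<in> carrier A; y \<in> carrier A\<rbrakk> \<Longrightarrow> x \<preceq> y \<or> y \<preceq> x"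
    and card: "infinite (carrier A) \<or> card (carrier A) \<ge> 3"
  shows "A \<cong>\<^sub>M\<^sub>V L 3 \<or> A \<cong>\<^sub>M\<^sub>V L 4 \<or> A \<cong>\<^sub>M\<^sub>V L 5"
proof -
  define H where "H = {x \<in> carrier A. x \<noteq> \<zero> \<and> x \<preceq> \<sim> x}"
  have cover: "x \<in> H \<or> \<sim> x \<in> H" if "x \<in> carrier A" "x \<noteq> \<zero>" "x \<noteq> \<^bold>1" for x
    using that total[of x "\<sim> x"] by (auto simp: H_def neg_eq_zero_iff)
  have HD [simp]: "x \<in> carrier A" "x \<noteq> \<zero>" "x \<preceq> \<sim> x" if "x \<in> H" for x
    using that by (simp_all add: H_def)
  \<comment> \<open>The smaller of the two lies below the larger, and each lies below its own
    negation.\<close>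
  have orth: "x \<preceq> \<sim> y" if "x \<in> H" "y \<in> H" for x y
    using total[of x y] le_trans[of x y "\<sim> y"] le_trans[of y x "\<sim> x"] le_neg_swap[of x y] that
    by auto
  have three: "x = y \<or> y = z \<or> x = z" if "x \<in> H" "y \<in> H" "z \<in> H" for x y z
    using triangle_free[of x y z] orth that by simp
  have "\<not> carrier A \<subseteq> {\<zero>, \<^bold>1}"
  proof
    assume "carrier A \<subseteq> {\<zero>, \<^bold>1}"
    then have "finite (carrier A)" "card (carrier A) \<le> card {\<zero>, \<^bold>1}"
      by (auto intro: finite_subset card_mono)
    then show False
      using card by (auto simp: card_insert_if split: if_splits)
  qed
  then obtain a where a: "a \<in> H"
    using cover by auto
  show ?thesis
  proof (cases "H = {a}")
    case True
    have "carrier A = {\<zero>, a, \<sim> a, \<^bold>1}"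
      using a cover True neg_neg by (auto; metis singletonD)
    then show ?thesis
      using iso_L3[of a] iso_L4[of a] a by (cases "\<sim> a = a") auto
  next
    case False
    obtain a b where ab: "a \<in> H" "b \<in> H" "a \<noteq> b" "a \<preceq> b"
      using False a total HD(1) by blast
    have "b \<preceq> \<sim> b"
      using ab by simp
    have "a \<preceq> \<sim> b" "\<sim> b \<noteq> \<zero>"
      using ab orth HD(1,2) \<open>b \<preceq> \<sim> b\<close> le_zero_iff by metis+
    moreover have "\<sim> b \<noteq> a"
      using ab le_antisym[of a b] \<open>b \<preceq> \<sim> b\<close> by auto
    \<comment> \<open>Since \<open>a \<preceq> b\<close>, the elements \<open>a\<close>,
      \<open>b\<close> and \<open>\<sim> b\<close> are pairwise orthogonal, so two of them coincide;
      the other two equalities are excluded.\<close>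
    ultimately have "\<sim> b = b"
      using triangle_free[of a b "\<sim> b"] ab by auto
    moreover have "H = {a, b}"
      using ab three by blast
    then have "carrier A = {\<zero>, a, b, \<sim> a, \<^bold>1}"
      using ab cover \<open>\<sim> b = b\<close> neg_neg by (auto; metis insertE singletonD)
    ultimately show ?thesis
      using iso_L5[of a b] ab by auto
  qed
qed

section \<open>Elements below one of two disjoint elements\<close>

text \<open>Supplies the distinctness needed when \<open>triangle_free\<close> is applied to
  elements below \<open>u\<close> together with \<open>v\<close>.\<close>

lemma disjoint_neq:
  assumes "u \<curlywedge> v = \<zero>" "w \<preceq> u" "v \<noteq> \<zero>" "u \<in> carrier A" "v \<in> carrier A" "w \<in> carrier A"
  shows "w \<noteq> v"
proof
  assume "w = v"
  then have "v \<preceq> u \<curlywedge> v"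
    using assms by (intro meet_greatest) auto
  then show False
    using assms by simp
qed

text \<open>The element \<open>w\<close> and its remainder \<open>u \<ominus> w\<close> are
  orthogonal to each other and, lying below \<open>u\<close>, to \<open>v\<close>. Neither is
  \<open>v\<close>, so they coincide: \<open>w\<close> is half of \<open>u\<close>.\<close>

lemma diff_eq_self:
  assumes "u \<curlywedge> v = \<zero>" "v \<noteq> \<zero>" "w \<preceq> u" "w \<noteq> \<zero>" "w \<noteq> u"
    and [simp]: "u \<in> carrier A" "v \<in> carrier A" "w \<in> carrier A"
  shows "u \<ominus> w = w"
proof -
  have "u \<ominus> w \<noteq> \<zero>"
    using assms le_antisym[of u w] by (auto simp: diff_eq_zero_iff)
  moreover have "w \<preceq> \<sim> (u \<ominus> w)"
    using diff_le_neg[of u w] by (simp add: le_neg_swap[of w])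
  moreover have "u \<ominus> w \<preceq> \<sim> v" "w \<preceq> \<sim> v"
    using assms by (auto intro!: meet_eq_zero_imp_le_neg meet_eq_zero_mono[of u v] simp: diff_le)
  moreover have "w \<noteq> v" "u \<ominus> w \<noteq> v"
    using assms disjoint_neq[of u v] by (auto simp: diff_le)
  ultimately show ?thesis
    using triangle_free[of w "u \<ominus> w" v] assms by auto
qed

text \<open>If \<open>w\<close> and \<open>w'\<close> are disjoint, they are pairwise orthogonal
  with \<open>v\<close>. Otherwise their meet is also strictly between zero and \<open>u\<close>, so
  all three are halves of \<open>u\<close>.\<close>

lemma strictly_between_unique:
  assumes "u \<curlywedge> v = \<zero>" "v \<noteq> \<zero>" "w \<preceq> u" "w \<noteq> \<zero>" "w \<noteq> u" "w' \<preceq> u" "w' \<noteq> \<zero>" "w' \<noteq> u"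
    and [simp]: "u \<in> carrier A" "v \<in> carrier A" "w \<in> carrier A" "w' \<in> carrier A"
  shows "w = w'"
proof (cases "w \<curlywedge> w' = \<zero>")
  case True
  have "w \<preceq> \<sim> v" "w' \<preceq> \<sim> v"
    using assms by (auto intro!: meet_eq_zero_imp_le_neg meet_eq_zero_mono[of u v])
  then show ?thesis
    using triangle_free[of w w' v] meet_eq_zero_imp_le_neg[OF True] disjoint_neq[of u v] assms
    by auto
next
  case False
  define m where "m = w \<curlywedge> w'"
  have m: "m \<in> carrier A" "m \<preceq> w" "m \<preceq> w'" "m \<noteq> \<zero>"
    using False by (simp_all add: m_def meet_le1 meet_le2)
  then have "m \<preceq> u" "m \<noteq> u"
    using assms le_trans[of m w u] le_antisym[of w u] by auto
  then have "u \<ominus> m = m"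
    using diff_eq_self[of u v m] assms m by auto
  \<comment> \<open>Differences are antitone in the second argument: \<open>m \<preceq> w\<close>
    gives \<open>w = u \<ominus> w \<preceq> u \<ominus> m = m\<close>.\<close>
  then have "w \<preceq> m" "w' \<preceq> m"
    using diff_mono[of u u m w] diff_mono[of u u m w'] diff_eq_self[of u v w]
      diff_eq_self[of u v w'] assms m by auto
  then show ?thesis
    using m le_antisym[of w m] le_antisym[of w' m] by auto
qed

text \<open>An element strictly between zero and \<open>u\<close> is unique, hence minimal; if there
  is none, \<open>u\<close> itself is the atom.\<close>

lemma exists_atom:
  assumes "u \<curlywedge> v = \<zero>" "u \<noteq> \<zero>" "v \<noteq> \<zero>" and [simp]: "u \<in> carrier A" "v \<in> carrier A"
  obtains a where "a \<in> carrier A" "a \<preceq> u" "a \<noteq> \<zero>"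
    "\<And>x. \<lbrakk>x \<in> carrier A; x \<preceq> a\<rbrakk> \<Longrightarrow> x = \<zero> \<or> x = a"
proof (cases "\<exists>w\<in>carrier A. w \<preceq> u \<and> w \<noteq> \<zero> \<and> w \<noteq> u")
  case True
  then obtain w where w: "w \<in> carrier A" "w \<preceq> u" "w \<noteq> \<zero>" "w \<noteq> u"
    by blast
  have "x = \<zero> \<or> x = w" if "x \<in> carrier A" "x \<preceq> w" for x
    using strictly_between_unique[of u v x w] w that le_trans[of x w u] le_antisym[of w u] assms
    by auto
  then show ?thesis
    using w that by blast
next
  case False
  then show ?thesis
    using assms that[of u] by auto
qed

text \<open>Otherwise \<open>u \<curlyvee> v\<close> is orthogonal to both \<open>u\<close> and
  \<open>v\<close>, and the three elements form a triangle.\<close>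

lemma disjoint_not_both_le_neg:
  assumes "u \<curlywedge> v = \<zero>" "u \<noteq> \<zero>" "v \<noteq> \<zero>" "u \<preceq> \<sim> u"
    and [simp]: "u \<in> carrier A" "v \<in> carrier A"
  shows "\<not> v \<preceq> \<sim> v"
proof
  assume "v \<preceq> \<sim> v"
  have "u \<preceq> \<sim> v"
    using assms by (intro meet_eq_zero_imp_le_neg)
  then have "v \<preceq> \<sim> u"
    by (simp add: le_neg_swap[of v])
  have "u \<curlyvee> v \<preceq> \<sim> u" "u \<curlyvee> v \<preceq> \<sim> v"
    using assms \<open>v \<preceq> \<sim> v\<close> \<open>u \<preceq> \<sim> v\<close> \<open>v \<preceq> \<sim> u\<close> by (simp_all add: join_least)
  then have "u \<preceq> \<sim> (u \<curlyvee> v)" "v \<preceq> \<sim> (u \<curlyvee> v)"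
    by (simp_all add: le_neg_swap[of _ "u \<curlyvee> v"])
  moreover have "v \<noteq> u \<curlyvee> v" "u \<noteq> v"
    using disjoint_neq[of v u u] disjoint_neq[of u v u] le_join1[of u v] assms
    by (auto simp: meet_comm)
  moreover have "u \<noteq> u \<curlyvee> v"
    using disjoint_neq[of u v v] le_join2[of u v] assms by auto
  moreover have "u \<curlyvee> v \<noteq> \<zero>"
    using le_join1[of u v] assms by auto
  ultimately show False
    using triangle_free[of u v "u \<curlyvee> v"] \<open>u \<preceq> \<sim> v\<close> assms by auto
qed

text \<open>The nonzero square of the atom \<open>b\<close> can only be \<open>b\<close>, so
  \<open>b\<close> is Boolean. Up to negation every element lies below \<open>\<sim> b\<close>, and
  at most one element lies strictly between zero and \<open>\<sim> b\<close>; whether it exists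
  decides between the two algebras.\<close>

lemma atom_iso:
  assumes atom: "\<And>x. \<lbrakk>x \<in> carrier A; x \<preceq> b\<rbrakk> \<Longrightarrow> x = \<zero> \<or> x = b"
    and "b \<noteq> \<zero>" "\<not> b \<preceq> \<sim> b" "\<sim> b \<noteq> \<zero>" and [simp]: "b \<in> carrier A"
  shows "A \<cong>\<^sub>M\<^sub>V B4 \<or> A \<cong>\<^sub>M\<^sub>V L 2 \<times>\<^sub>M\<^sub>V L 3"
proof -
  have "b \<ominus> \<sim> b = b"
    using atom[of "b \<ominus> \<sim> b"] assms by (auto simp: diff_le diff_eq_zero_iff)
  then have "\<sim> b \<oplus> \<sim> b = \<sim> b"
    by (metis assms(5) diff_def neg_closed neg_neg plus_closed)
  then have idem: "b \<curlywedge> \<sim> b = \<zero>"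
    using idem_imp_meet_neg[of "\<sim> b"] by (simp add: meet_comm)
  \<comment> \<open>The meet with the atom \<open>b\<close> is either zero, so \<open>x\<close> lies
    below \<open>\<sim> b\<close>, or \<open>b\<close>, so \<open>b \<preceq> x\<close>.\<close>
  have split: "x \<preceq> \<sim> b \<or> \<sim> x \<preceq> \<sim> b" if "x \<in> carrier A" for x
    using atom[of "x \<curlywedge> b"] that meet_eq_zero_imp_le_neg[of x b] meet_le1[of x b]
    by (auto simp: meet_le2 neg_le_neg_iff)
  show ?thesis
  proof (cases "\<exists>w\<in>carrier A. w \<preceq> \<sim> b \<and> w \<noteq> \<zero> \<and> w \<noteq> \<sim> b")
    case False
    have "x \<in> {\<zero>, b, \<sim> b, \<^bold>1}" if "x \<in> carrier A" for x
      using split[of x] False that neg_inject[of x b] by (auto simp: neg_eq_zero_iff)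
    then have "carrier A = {\<zero>, b, \<sim> b, \<^bold>1}"
      by auto
    then show ?thesis
      using iso_B4[of b] assms idem by blast
  next
    case True
    then obtain w where w: "w \<in> carrier A" "w \<preceq> \<sim> b" "w \<noteq> \<zero>" "w \<noteq> \<sim> b"
      by blast
    have disj: "\<sim> b \<curlywedge> b = \<zero>"
      using idem by (simp add: meet_comm)
    have below: "x = \<zero> \<or> x = w \<or> x = \<sim> b" if "x \<in> carrier A" "x \<preceq> \<sim> b" for x
      using strictly_between_unique[OF disj, of x w] w that assms by auto
    have "x \<in> {\<zero>, w, \<sim> b, b, \<sim> w, \<^bold>1}" if "x \<in> carrier A" for x
      using split[of x] below[of x] below[of "\<sim> x"] that w neg_inject[of x b]
      by (auto simp: neg_eq_zero_iff)
    then have "carrier A = {\<zero>, w, \<sim> b, b, \<sim> w, \<^bold>1}"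
      using w by auto
    moreover have diff: "\<sim> b \<ominus> w = w"
      using diff_eq_self[OF disj, of w] w assms by auto
    then have "\<sim> (b \<oplus> w) = w"
      by (simp add: diff_def)
    then have "b \<oplus> w = \<sim> w"
      using w neg_neg[of "b \<oplus> w"] by simp
    moreover have "w \<oplus> w = \<sim> b"
      using plus_diff[of w "\<sim> b"] diff w by (simp add: join_absorb)
    ultimately show ?thesis
      using iso_L2_L3[of w b] w assms idem by blast
  qed
qed

lemma iso_cases:
  assumes "infinite (carrier A) \<or> card (carrier A) \<ge> 3"
  shows "A \<cong>\<^sub>M\<^sub>V L 3 \<or> A \<cong>\<^sub>M\<^sub>V L 4 \<or> A \<cong>\<^sub>M\<^sub>V L 5 \<or> A \<cong>\<^sub>M\<^sub>V B4 \<or> A \<cong>\<^sub>M\<^sub>V L 2 \<times>\<^sub>M\<^sub>V L 3"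
proof (cases "\<forall>x\<in>carrier A. \<forall>y\<in>carrier A. x \<preceq> y \<or> y \<preceq> x")
  case True
  then show ?thesis
    using chain_iso assms by blast
next
  case False
  then obtain x y where [simp]: "x \<in> carrier A" "y \<in> carrier A" and "\<not> x \<preceq> y" "\<not> y \<preceq> x"
    by blast
  define u v where "u = x \<ominus> y" and "v = y \<ominus> x"
  have [simp]: "u \<in> carrier A" "v \<in> carrier A" and nz: "u \<noteq> \<zero>" "v \<noteq> \<zero>"
    and disj: "u \<curlywedge> v = \<zero>"
    using \<open>\<not> x \<preceq> y\<close> \<open>\<not> y \<preceq> x\<close>
    by (simp_all add: u_def v_def diff_eq_zero_iff meet_diff_diff_eq_zero)
  obtain a where a: "a \<in> carrier A" "a \<preceq> u" "a \<noteq> \<zero>"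
    "\<And>x. \<lbrakk>x \<in> carrier A; x \<preceq> a\<rbrakk> \<Longrightarrow> x = \<zero> \<or> x = a"
    using exists_atom[of u v] nz disj by auto
  obtain b where b: "b \<in> carrier A" "b \<preceq> v" "b \<noteq> \<zero>"
    "\<And>x. \<lbrakk>x \<in> carrier A; x \<preceq> b\<rbrakk> \<Longrightarrow> x = \<zero> \<or> x = b"
    using exists_atom[of v u] nz disj by (auto simp: meet_comm)
  have ab: "a \<curlywedge> b = \<zero>"
    using meet_eq_zero_mono[of u v a b] a b disj by simp
  have "a \<preceq> \<sim> b"
    using meet_eq_zero_imp_le_neg ab a b by blast
  then have "b \<preceq> \<sim> a"
    using a b by (simp add: le_neg_swap[of b])
  have "\<sim> a \<noteq> \<zero>" "\<sim> b \<noteq> \<zero>"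
    using \<open>a \<preceq> \<sim> b\<close> \<open>b \<preceq> \<sim> a\<close> a b by auto
  \<comment> \<open>At most one of the atoms \<open>a\<close>, \<open>b\<close> lies below its
    negation; \<open>atom_iso\<close> applies to the other.\<close>
  then show ?thesis
    using disjoint_not_both_le_neg[of a b] ab atom_iso[of a] atom_iso[of b] a b by blast
qed

end

section \<open>Cycles in zero-divisor graphs\<close>

lemma pcas_imp_pawalk_verts: "pcas u p v \<Longrightarrow> pawalk_verts u p = u # map snd p"
  by (induction p arbitrary: u) auto

lemma pcas_imp_fst_nth: "pcas u p v \<Longrightarrow> i < length p \<Longrightarrow> fst (p ! i) = (u # map snd p) ! i"
  by (induction p arbitrary: u i) (auto simp: nth_Cons split: nat.split)

lemma pcas_imp_last: "pcas u p v \<Longrightarrow> last (u # map snd p) = v"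
  by (induction p arbitrary: u) auto

text \<open>The set consists of the vertices on the cycle, each of which has its predecessor and its
  successor as neighbours.\<close>

lemma cycle_imp_neighbours_on_cycle:
  fixes G :: "'a pair_pre_digraph"
  assumes "pre_digraph.cycle (with_proj G) p" and len: "length p \<ge> 3"
  shows "\<exists>S\<subseteq>snd ` parcs G. S \<noteq> {} \<and>
    (\<forall>v\<in>S. \<exists>u\<in>S. \<exists>w\<in>S. u \<noteq> w \<and> (u, v) \<in> parcs G \<and> (v, w) \<in> parcs G)"
proof -
  obtain u where arcs: "set p \<subseteq> parcs G" and walk: "pcas u p u"
    and "distinct (tl (pawalk_verts u p))"
    using assms by (auto simp: pre_digraph.cycle_def pre_digraph.awalk_def cas_with_proj_eq
        awalk_verts_with_proj_eq)
  define n w where "n = length p" and "w i = snd (p ! i)" for i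
  \<comment> \<open>The \<open>tl\<close> drops the start vertex, which reappears as the head of the
    last arc.\<close>
  have "distinct (map snd p)"
    using walk \<open>distinct (tl _)\<close> by (simp add: pcas_imp_pawalk_verts)
  then have inj: "w i = w j \<longleftrightarrow> i = j" if "i < n" "j < n" for i j
    using that nth_eq_iff_index_eq[of "map snd p" i j] by (simp add: w_def n_def)
  have step: "(w i, w (Suc i)) \<in> parcs G" if "Suc i < n" for i
  proof -
    have "p ! Suc i = (w i, w (Suc i))"
      using that pcas_imp_fst_nth[OF walk, of "Suc i"] by (simp add: w_def n_def prod_eq_iff)
    then show ?thesis
      using arcs that nth_mem[of "Suc i" p] by (auto simp: n_def)
  qed
  have wrap: "(w (n - 1), w 0) \<in> parcs G"
  proof -
    have "p \<noteq> []"
      using len by auto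
    then have "w (n - 1) = u"
      using pcas_imp_last[OF walk] by (simp add: w_def n_def last_map last_conv_nth)
    then have "p ! 0 = (w (n - 1), w 0)"
      using \<open>p \<noteq> []\<close> pcas_imp_fst_nth[OF walk, of 0] by (simp add: w_def prod_eq_iff)
    then show ?thesis
      using arcs \<open>p \<noteq> []\<close> nth_mem[of 0 p] by auto
  qed
  have "\<exists>u\<in>w ` {..<n}. \<exists>x\<in>w ` {..<n}. u \<noteq> x \<and> (u, w i) \<in> parcs G \<and> (w i, x) \<in> parcs G"
    if "i < n" for i
  proof -
    \<comment> \<open>Cyclic predecessor and successor of \<open>i\<close>; they would coincide for
      \<open>n = 2\<close>, which is where the length bound enters.\<close>
    define j where "j = (if i = 0 then n - 1 else i - 1)"
    define k where "k = (if Suc i = n then 0 else Suc i)"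
    have "j < n" "k < n" "j \<noteq> k"
      using that len by (auto simp: j_def k_def n_def)
    moreover have "(w j, w i) \<in> parcs G"
      using step[of "i - 1"] wrap that by (auto simp: j_def)
    moreover have "(w i, w k) \<in> parcs G"
      using step[of i] wrap that by (auto simp: k_def)
    ultimately show ?thesis
      using inj[of j k] by blast
  qed
  moreover have "w ` {..<n} \<subseteq> snd ` parcs G"
    using arcs nth_mem by (fastforce simp: w_def n_def)
  moreover have "w ` {..<n} \<noteq> {}"
    using len by (auto simp: n_def lessThan_empty_iff)
  ultimately show ?thesis
    by (intro exI[of _ "w ` {..<n}"]) blast
qed

text \<open>
  A consequence of having a cycle that is easy to refute in a concrete algebra, since no lists are
  involved, and that is invariant under isomorphism.
\<close>

definition has_two_core :: "('a, 'm) mv_scheme \<Rightarrow> bool" where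
  "has_two_core A \<longleftrightarrow> (\<exists>S\<subseteq>carrier A - {\<zero>\<^bsub>A\<^esub>}. S \<noteq> {} \<and> (\<forall>v\<in>S. \<exists>u\<in>S. \<exists>w\<in>S.
     u \<noteq> v \<and> w \<noteq> v \<and> u \<noteq> w \<and> u \<odot>\<^bsub>A\<^esub> v = \<zero>\<^bsub>A\<^esub> \<and> v \<odot>\<^bsub>A\<^esub> w = \<zero>\<^bsub>A\<^esub>))"

lemma has_two_coreE:
  assumes "has_two_core A"
  obtains S where "S \<subseteq> carrier A - {\<zero>\<^bsub>A\<^esub>}" "S \<noteq> {}"
    "\<And>v. v \<in> S \<Longrightarrow> \<exists>u\<in>S. \<exists>w\<in>S.
       u \<noteq> v \<and> w \<noteq> v \<and> u \<noteq> w \<and> u \<odot>\<^bsub>A\<^esub> v = \<zero>\<^bsub>A\<^esub> \<and> v \<odot>\<^bsub>A\<^esub> w = \<zero>\<^bsub>A\<^esub>"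
  using assms unfolding has_two_core_def by blast

section \<open>Girth infinity and girth three\<close>

text \<open>The vertices of a cycle form a set as in \<open>has_two_core\<close>, so the infimum
  defining the girth runs over the empty set.\<close>

lemma girth_eq_infinity:
  assumes "\<not> has_two_core A"
  shows "girth (zero_divisor_graph A) = \<infinity>"
proof -
  have False if cycle: "pre_digraph.cycle (with_proj (zero_divisor_graph A)) p" "length p \<ge> 3" for p
  proof -
    let ?E = "parcs (zero_divisor_graph A)"
    obtain S where S: "S \<subseteq> snd ` ?E" "S \<noteq> {}"
      "\<forall>v\<in>S. \<exists>u\<in>S. \<exists>w\<in>S. u \<noteq> w \<and> (u, v) \<in> ?E \<and> (v, w) \<in> ?E"
      using cycle_imp_neighbours_on_cycle[OF cycle] by blast
    have "S \<subseteq> carrier A - {\<zero>\<^bsub>A\<^esub>}"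
      using S(1) by (auto simp: zero_divisor_graph_def nonzero_zero_divisors_def)
    moreover have "u \<noteq> v \<and> u \<odot>\<^bsub>A\<^esub> v = \<zero>\<^bsub>A\<^esub>" if "(u, v) \<in> ?E" for u v
      using that by (auto simp: zero_divisor_graph_def)
    ultimately have "has_two_core A"
      unfolding has_two_core_def using S by (intro exI[of _ S]) metis
    then show False
      using assms by simp
  qed
  then have "{p. pre_digraph.cycle (with_proj (zero_divisor_graph A)) p \<and> length p \<ge> 3} = {}"
    by blast
  then show ?thesis
    by (simp only: girth_def image_empty Inf_enat_def) simp
qed

lemma girth_eq_3:
  assumes "mv_algebra A" "{x, y, z} \<subseteq> carrier A - {\<zero>\<^bsub>A\<^esub>}" "x \<noteq> y" "y \<noteq> z" "x \<noteq> z"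
    and "x \<odot>\<^bsub>A\<^esub> y = \<zero>\<^bsub>A\<^esub>" "y \<odot>\<^bsub>A\<^esub> z = \<zero>\<^bsub>A\<^esub>" "x \<odot>\<^bsub>A\<^esub> z = \<zero>\<^bsub>A\<^esub>"
  shows "girth (zero_divisor_graph A) = 3"
proof (rule antisym)
  let ?P = "{p. pre_digraph.cycle (with_proj (zero_divisor_graph A)) p \<and> length p \<ge> 3}"
  \<comment> \<open>The arc closing the triangle needs the third product in reversed order.\<close>
  have "z \<odot>\<^bsub>A\<^esub> x = \<zero>\<^bsub>A\<^esub>"
    using assms mv_algebra.times_comm[of A z x] by auto
  then have "{x, y, z} \<subseteq> nonzero_zero_divisors A"
    using assms unfolding nonzero_zero_divisors_def by blast
  then have "[(x, y), (y, z), (z, x)] \<in> ?P"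
    using assms \<open>z \<odot>\<^bsub>A\<^esub> x = \<zero>\<^bsub>A\<^esub>\<close>
    by (auto simp: pre_digraph.cycle_def pre_digraph.awalk_def zero_divisor_graph_def
      cas_with_proj_eq awalk_verts_with_proj_eq
      intro!: exI[of _ x])
  from INF_lower[OF this, of "\<lambda>p. enat (length p)"]
  show "girth (zero_divisor_graph A) \<le> 3"
    by (simp add: girth_def numeral_eq_enat eval_nat_numeral)
  show "3 \<le> girth (zero_divisor_graph A)"
    by (auto simp: girth_def numeral_eq_enat intro!: INF_greatest)
qed

lemma (in mv_algebra) girth_eq_3_if_not_triangle_free:
  assumes "\<not> triangle_free_mv_algebra A"
  shows "girth (zero_divisor_graph A) = 3"
proof -
  obtain x y z where "{x, y, z} \<subseteq> carrier A - {\<zero>}" "x \<noteq> y" "y \<noteq> z" "x \<noteq> z"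
    "x \<preceq> \<sim> y" "y \<preceq> \<sim> z" "x \<preceq> \<sim> z"
    using assms
    by (auto simp: triangle_free_mv_algebra_def triangle_free_mv_algebra_axioms_def
      mv_algebra_axioms)
  then show ?thesis
    using girth_eq_3[OF mv_algebra_axioms, of x y z] by (simp add: times_eq_zero_iff)
qed

text \<open>An isomorphism also preserves the derived product, so it maps the witnessing set to one
  in \<open>B\<close>. This reduces infinite girth to five concrete algebras.\<close>

lemma has_two_core_iso:
  fixes A (structure)
  assumes "mv_algebra A" "A \<cong>\<^sub>M\<^sub>V B" "has_two_core A"
  shows "has_two_core B"
proof -
  interpret mv_algebra A by fact
  obtain f where f: "bij_betw f (carrier A) (carrier B)"
    "\<And>x y. x \<in> carrier A \<Longrightarrow> y \<in> carrier A \<Longrightarrow> f (x \<oplus> y) = f x \<oplus>\<^bsub>B\<^esub> f y"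
    "\<And>x. x \<in> carrier A \<Longrightarrow> f (\<sim> x) = \<sim>\<^bsub>B\<^esub> f x" "f \<zero> = \<zero>\<^bsub>B\<^esub>"
    using assms(2) unfolding mv_iso_def by blast
  have inj: "f x = f y \<longleftrightarrow> x = y" if "x \<in> carrier A" "y \<in> carrier A" for x y
    using f(1) that by (auto simp: bij_betw_def inj_on_def)
  have times: "f x \<odot>\<^bsub>B\<^esub> f y = \<zero>\<^bsub>B\<^esub>" if "x \<in> carrier A" "y \<in> carrier A" "x \<odot> y = \<zero>" for x y
  proof -
    have "f (x \<odot> y) = f x \<odot>\<^bsub>B\<^esub> f y"
      unfolding mv_times_def using that(1,2) f by simp
    then show ?thesis
      using that f(4) by simp
  qed
  obtain S where S: "S \<subseteq> carrier A - {\<zero>}" "S \<noteq> {}"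
    "\<And>v. v \<in> S \<Longrightarrow> \<exists>u\<in>S. \<exists>w\<in>S.
       u \<noteq> v \<and> w \<noteq> v \<and> u \<noteq> w \<and> u \<odot> v = \<zero> \<and> v \<odot> w = \<zero>"
    using assms(3) unfolding has_two_core_def by blast
  have "f ` S \<subseteq> carrier B - {\<zero>\<^bsub>B\<^esub>}"
    using S(1) f(1) inj[of _ \<zero>] by (auto simp: f(4) bij_betw_def)
  moreover have "\<exists>u\<in>f ` S. \<exists>w\<in>f ` S. u \<noteq> f v \<and> w \<noteq> f v \<and> u \<noteq> w \<and>
      u \<odot>\<^bsub>B\<^esub> f v = \<zero>\<^bsub>B\<^esub> \<and> f v \<odot>\<^bsub>B\<^esub> w = \<zero>\<^bsub>B\<^esub>" if "v \<in> S" for v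
  proof -
    obtain u w where "u \<in> S" "w \<in> S" "u \<noteq> v" "w \<noteq> v" "u \<noteq> w" "u \<odot> v = \<zero>" "v \<odot> w = \<zero>"
      using S(3)[OF \<open>v \<in> S\<close>] by blast
    moreover from this have "u \<in> carrier A" "v \<in> carrier A" "w \<in> carrier A"
      using S(1) that by auto
    ultimately show ?thesis
      using inj times by blast
  qed
  ultimately show ?thesis
    unfolding has_two_core_def using S(2) by (intro exI[of _ "f ` S"]) blast
qed

section \<open>Absence of cycles in the five exceptional algebras\<close>

lemma times_L: "x \<odot>\<^bsub>L n\<^esub> y = 1 - min 1 (2 - x - y)"
  by (simp add: mv_times_def L_def)

text \<open>Orthogonality means \<open>x + y \<le> 1\<close>. From 1/2 upwards an element has at
  most one other neighbour in the chain, so \<open>S\<close> shrinks to at most one element.\<close>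

lemma not_has_two_core_L:
  assumes "n \<in> {3, 4, 5}"
  shows "\<not> has_two_core (L n)"
proof
  assume "has_two_core (L n)"
  then obtain S where S: "S \<subseteq> carrier (L n) - {0}" "S \<noteq> {}" "\<And>v. v \<in> S \<Longrightarrow> \<exists>u\<in>S. \<exists>w\<in>S.
      u \<noteq> v \<and> w \<noteq> v \<and> u \<noteq> w \<and> u + v \<le> 1 \<and> w + v \<le> 1"
    by (elim has_two_coreE) (simp add: times_L, simp add: L_def min_def, smt (verit, best))
  \<comment> \<open>One set for all three chains: the thirds belong to \<open>n = 4\<close>, and
    \<open>L 3\<close> is treated inside \<open>L 5\<close>.\<close>
  have sub: "S \<subseteq> {1/4, 1/3, 1/2, 2/3, 3/4, 1} - (if n = 4 then {1/4, 1/2, 3/4} else {1/3, 2/3})"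
    using S(1) assms by (auto simp: carrier_L)
  have no: "v \<notin> S" if v: "v \<in> {1/2, 2/3, 3/4, 1}" for v
  proof
    assume "v \<in> S"
    then obtain u w where uw: "u \<in> S" "w \<in> S" "u \<noteq> v" "w \<noteq> v" "u \<noteq> w" "u + v \<le> 1" "w + v \<le> 1"
      using S(3) by blast
    have "x = (if n = 4 then 1/3 else 1/4)" if "x \<in> S" "x \<noteq> v" "x + v \<le> 1" for x
      using that \<open>v \<in> S\<close> v subsetD[OF sub, of x] subsetD[OF sub, of v]
      by (cases "n = 4") auto
    then show False
      using uw by metis
  qed
  then have "S \<subseteq> {1/4, 1/3}"
    using sub by (auto split: if_splits)
  then have "S \<subseteq> {1/4} \<or> S \<subseteq> {1/3}"
    using sub by (cases "n = 4") auto
  then show False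
    using S(2,3) by blast
qed

text \<open>Disjoint nonempty subsets of a two-element set are complementary, so no vertex has two
  neighbours.\<close>

lemma not_has_two_core_B4: "\<not> has_two_core B4"
proof
  have compl: "u = - v" if disj: "u \<inter> v = {}" "u \<noteq> {}" "v \<noteq> {}" for u v :: "bool set"
  proof -
    obtain a c where "a \<in> u" "c \<in> v"
      using disj by blast
    then have "x \<in> u \<longleftrightarrow> x \<notin> v" for x
      using disj(1) by (cases x; cases a; cases c) auto
    then show ?thesis
      by (simp add: set_eq_iff)
  qed
  have times: "u \<odot>\<^bsub>B4\<^esub> v = u \<inter> v" and zero: "\<zero>\<^bsub>B4\<^esub> = {}" for u v
    by (simp_all add: mv_times_def B4_def mv_of_boolean_algebra_def)
  assume "has_two_core B4"
  then obtain S where S: "S \<subseteq> carrier B4 - {{}}" "S \<noteq> {}"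
    "\<forall>v\<in>S. \<exists>u\<in>S. \<exists>w\<in>S. u \<noteq> v \<and> w \<noteq> v \<and> u \<noteq> w \<and> u \<inter> v = {} \<and> v \<inter> w = {}"
    unfolding has_two_core_def times zero by (elim exE conjE) (rule that)
  then obtain v where "v \<in> S"
    by blast
  obtain u w where "u \<in> S" "w \<in> S" "u \<noteq> w" "u \<inter> v = {}" "v \<inter> w = {}"
    using bspec[OF S(3) \<open>v \<in> S\<close>] by (elim bexE conjE) (rule that)
  moreover from this have "u \<noteq> {}" "v \<noteq> {}" "w \<noteq> {}"
    using S(1) \<open>v \<in> S\<close> by auto
  ultimately show False
    using compl[of u v] compl[of w v] by (simp add: Int_commute)
qed

text \<open>Discarding the elements with at most one neighbour leaves only \<open>(0, 1/2)\<close>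
  and \<open>(1, 0)\<close>, too few for two neighbours each.\<close>

lemma not_has_two_core_L2_L3: "\<not> has_two_core (L 2 \<times>\<^sub>M\<^sub>V L 3)"
proof
  have times: "x \<odot>\<^bsub>L 2 \<times>\<^sub>M\<^sub>V L 3\<^esub> y = (fst x \<odot>\<^bsub>L 2\<^esub> fst y, snd x \<odot>\<^bsub>L 3\<^esub> snd y)" for x y
    by (simp add: mv_times_def mv_prod_def case_prod_beta)
  assume "has_two_core (L 2 \<times>\<^sub>M\<^sub>V L 3)"
  then obtain S where S: "S \<subseteq> carrier (L 2 \<times>\<^sub>M\<^sub>V L 3) - {(0, 0)}" "S \<noteq> {}"
    "\<And>v. v \<in> S \<Longrightarrow> \<exists>u\<in>S. \<exists>w\<in>S. u \<noteq> v \<and> w \<noteq> v \<and> u \<noteq> w \<and>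
       fst u + fst v \<le> 1 \<and> snd u + snd v \<le> 1 \<and> fst w + fst v \<le> 1 \<and> snd w + snd v \<le> 1"
    by (elim has_two_coreE)
      (simp add: times times_L, simp add: mv_prod_def L_def min_def, smt (verit, best))
  have sub: "S \<subseteq> {(0, 1/2), (0, 1), (1, 0), (1, 1/2), (1, 1)}"
    using S(1) by (auto simp: mv_prod_def carrier_L)
  have one_neighbour: "v \<notin> S"
    if "\<And>u. \<lbrakk>u \<in> {(0, 1/2), (0, 1), (1, 0), (1, 1/2), (1, 1)}; fst u + fst v \<le> 1;
      snd u + snd v \<le> 1\<rbrakk> \<Longrightarrow> u = c" for v c
  proof
    assume "v \<in> S"
    then obtain u w where uw: "u \<in> S" "w \<in> S" "u \<noteq> w" "fst u + fst v \<le> 1" "snd u + snd v \<le> 1"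
      "fst w + fst v \<le> 1" "snd w + snd v \<le> 1"
      using S(3) by blast
    have "u = c" "w = c"
      using that[OF subsetD[OF sub \<open>u \<in> S\<close>]] that[OF subsetD[OF sub \<open>w \<in> S\<close>]] uw by simp_all
    then show False
      using uw by simp
  qed
  \<comment> \<open>Nothing nonzero is orthogonal to the top, so the candidate neighbour given here
    is arbitrary.\<close>
  have "(1, 1) \<notin> S"
    by (rule one_neighbour[of "(1, 1)" "(0, 1/2)"]) auto
  moreover have "(1, 1/2) \<notin> S"
    by (rule one_neighbour[of "(1, 1/2)" "(0, 1/2)"]) auto
  moreover have "(0, 1) \<notin> S"
    by (rule one_neighbour[of "(0, 1)" "(1, 0)"]) auto
  ultimately have "S \<subseteq> {(0, 1/2), (1, 0)}"
    using sub by auto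
  then show False
    using S(2,3) by blast
qed

theorem theorem3p4:
  fixes A :: "('a, 'm) mv_scheme"
  assumes "mv_algebra A"
    and "infinite (carrier A) \<or> card (carrier A) \<ge> 3"
  shows "girth (zero_divisor_graph A) =
    (if A \<cong>\<^sub>M\<^sub>V L 3 \<or> A \<cong>\<^sub>M\<^sub>V L 4 \<or> A \<cong>\<^sub>M\<^sub>V L 5 \<or> A \<cong>\<^sub>M\<^sub>V B4 \<or> A \<cong>\<^sub>M\<^sub>V L 2 \<times>\<^sub>M\<^sub>V L 3
     then \<infinity> else 3)"
proof (cases "A \<cong>\<^sub>M\<^sub>V L 3 \<or> A \<cong>\<^sub>M\<^sub>V L 4 \<or> A \<cong>\<^sub>M\<^sub>V L 5 \<or> A \<cong>\<^sub>M\<^sub>V B4 \<or> A \<cong>\<^sub>M\<^sub>V L 2 \<times>\<^sub>M\<^sub>V L 3")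
  case True
  then have "\<not> has_two_core A"
    by (auto dest!: has_two_core_iso[OF assms(1)]
      simp: not_has_two_core_L not_has_two_core_B4 not_has_two_core_L2_L3)
  then show ?thesis
    using True by (simp add: girth_eq_infinity)
next
  case False
  then have "\<not> triangle_free_mv_algebra A"
    using triangle_free_mv_algebra.iso_cases[OF _ assms(2)] by blast
  then have "girth (zero_divisor_graph A) = 3"
    by (rule mv_algebra.girth_eq_3_if_not_triangle_free[OF assms(1)])
  then show ?thesis
    using False by simp
qed

end
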